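(* Let $r\ge 2$ be an integer, let $k>2^{9r}$ and $m>0$ be real numbers, and let $c\ge 0$ be an integer. Let $\mathcal H,\mathcal H_1,\dots,\mathcal H_\ell$ be $r$-uniform, $r$-partite hypergraphs such that $\mathcal H$ is $c$-Ryser-stable relative to $\mathcal H_1,\dots,\mathcal H_\ell$. Let $(V,d_1,\dots,d_r)$ be a family of metrics with common vertex set $V$ which contains an $(m,km)$-dual of $\mathcal H$. Then at least one of the following holds: (1) $V$ can be covered by $c$ balls of radius $km$, each being a ball in one of the metrics $d_1,\dots,d_r$; (2) there is a real number $m'$ with $m\le m'\le km$ such that $(V,d_1,\dots,d_r)$ contains an $(m',k^{\frac{1}{4r}}m')$-dual of one of $\mathcal H_1,\dots,\mathcal H_\ell$.
   Context: Hypergraphs are finite, with a set of edges (no repeated edges). An $r$-uniform, $r$-partite hypergraph comes with an ordered partition of its vertex set into parts $1,\dots,r$, and each edge contains exactly one vertex from each part. A hypergraph contains a copy of another if it has a subhypergraph isomorphic to it via an isomorphism mapping part $i$ to part $i$ for each $i$. A vertex cover of $\mathcal H$ is a set of vertices meeting every edge. $\mathcal H$ is $c$-Ryser-stable relative to $\mathcal H_1,\dots,\mathcal H_\ell$ if there is a vertex cover $C$ of $\mathcal H$ with $|C|\le c$ such that every $r$-uniform, $r$-partite hypergraph $\mathcal H'$ containing $\mathcal H$ as a subhypergraph (with compatible parts) satisfies at least one of: $C$ is a vertex cover of $\mathcal H'$; or $\mathcal H'$ contains a copy of $\mathcal H_i$ for some $i$. A family of metrics $(V,d_1,\dots,d_r)$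 with common vertex set is a nonempty finite set $V$ together with metrics $d_1,\dots,d_r:V\times V\to\mathbb R$. For real $a<b$, an injection $\phi:E(\mathcal H)\to V$ is an $(a,b)$-duality if for all distinct edges $e,f$ of $\mathcal H$ and each $i\in\{1,\dots,r\}$: if $e$ and $f$ share their vertex in part $i$ then $d_i(\phi(e),\phi(f))\le a$; and if $e$ and $f$ do not share their vertex in part $i$ then $d_i(\phi(e),\phi(f))\ge b$. $(V,d_1,\dots,d_r)$ contains an $(a,b)$-dual of $\mathcal H$ if such a $\phi$ exists. The ball of radius $\rho$ around $x$ in $d_i$ is $\{y\in V: d_i(x,y)\le\rho\}$. Covering by $c$ balls means that at most $c$ such balls have union $V$. *)

theory Defs
  imports "HOL-Analysis.Analysis" "HOL-Library.Infinite_Typeclass"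
begin

text \<open>Parts are indexed by \<open>{1..r}\<close>; the value of \<open>part\<close> at other indices is irrelevant
  and is never consulted.\<close>

record 'v hypergraph =
  part :: "nat \<Rightarrow> 'v set"
  edges :: "'v set set"

definition verts :: "nat \<Rightarrow> 'v hypergraph \<Rightarrow> 'v set" where
  "verts r H = (\<Union>i\<in>{1..r}. part H i)"

definition uniform_partite :: "nat \<Rightarrow> 'v hypergraph \<Rightarrow> bool" where
  "uniform_partite r H \<longleftrightarrow>
     finite (verts r H) \<and>
     disjoint_family_on (part H) {1..r} \<and>
     (\<forall>e\<in>edges H. e \<subseteq> verts r H \<and> card e = r \<and> (\<forall>i\<in>{1..r}. card (e \<inter> part H i) = 1))"

definition subhypergraph :: "nat \<Rightarrow> 'v hypergraph \<Rightarrow> 'v hypergraph \<Rightarrow> bool" where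
  "subhypergraph r H H' \<longleftrightarrow>
     (\<forall>i\<in>{1..r}. part H i \<subseteq> part H' i) \<and> edges H \<subseteq> edges H'"

definition partite_iso :: "nat \<Rightarrow> ('v \<Rightarrow> 'w) \<Rightarrow> 'v hypergraph \<Rightarrow> 'w hypergraph \<Rightarrow> bool" where
  "partite_iso r f F G \<longleftrightarrow>
     bij_betw f (verts r F) (verts r G) \<and>
     (\<forall>i\<in>{1..r}. f ` part F i = part G i) \<and>
     (\<lambda>e. f ` e) ` edges F = edges G"

definition contains_copy :: "nat \<Rightarrow> 'v hypergraph \<Rightarrow> 'w hypergraph \<Rightarrow> bool" where
  "contains_copy r H F \<longleftrightarrow>
     (\<exists>G f. uniform_partite r G \<and> subhypergraph r G H \<and> partite_iso r f F G)"

definition vertex_cover :: "nat \<Rightarrow> 'v hypergraph \<Rightarrow> 'v set \<Rightarrow> bool" where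
  "vertex_cover r H C \<longleftrightarrow> C \<subseteq> verts r H \<and> (\<forall>e\<in>edges H. e \<inter> C \<noteq> {})"

text \<open>The extensions \<open>H'\<close> range over hypergraphs on the same vertex type as \<open>H\<close>. As that type
  is infinite and all hypergraphs are finite, every abstract finite extension of \<open>H\<close> occurs
  among them up to an isomorphism fixing \<open>H\<close>; over a finite type the notion would be too weak.\<close>

definition ryser_stable ::
    "nat \<Rightarrow> nat \<Rightarrow> 'v::infinite hypergraph \<Rightarrow> nat \<Rightarrow> (nat \<Rightarrow> 'w hypergraph) \<Rightarrow> bool" where
  "ryser_stable r c H l Hs \<longleftrightarrow>
     (\<exists>C. vertex_cover r H C \<and> card C \<le> c \<and>
       (\<forall>H'. uniform_partite r H' \<and> subhypergraph r H H' \<longrightarrow>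
          vertex_cover r H' C \<or> (\<exists>i\<in>{1..l}. contains_copy r H' (Hs i))))"

text \<open>The locale \<open>Metric_space\<close> asks for nonnegativity and symmetry of the distance also outside
  the carrier. Every metric on \<open>V\<close> extends in this way (by 0), and the values outside \<open>V\<close> are
  not used below.\<close>

definition metric_family :: "nat \<Rightarrow> 'p set \<Rightarrow> (nat \<Rightarrow> 'p \<Rightarrow> 'p \<Rightarrow> real) \<Rightarrow> bool" where
  "metric_family r V d \<longleftrightarrow> finite V \<and> V \<noteq> {} \<and> (\<forall>i\<in>{1..r}. Metric_space V (d i))"

definition is_duality ::
    "nat \<Rightarrow> 'p set \<Rightarrow> (nat \<Rightarrow> 'p \<Rightarrow> 'p \<Rightarrow> real) \<Rightarrow> real \<Rightarrow> real \<Rightarrow> 'v hypergraph \<Rightarrow> ('v set \<Rightarrow> 'p) \<Rightarrow> bool"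
  where
  "is_duality r V d a b H \<phi> \<longleftrightarrow>
     a < b \<and> inj_on \<phi> (edges H) \<and> \<phi> ` edges H \<subseteq> V \<and>
     (\<forall>e\<in>edges H. \<forall>f\<in>edges H. e \<noteq> f \<longrightarrow>
       (\<forall>i\<in>{1..r}.
          (e \<inter> part H i = f \<inter> part H i \<longrightarrow> d i (\<phi> e) (\<phi> f) \<le> a) \<and>
          (e \<inter> part H i \<noteq> f \<inter> part H i \<longrightarrow> d i (\<phi> e) (\<phi> f) \<ge> b)))"

definition contains_dual ::
    "nat \<Rightarrow> 'p set \<Rightarrow> (nat \<Rightarrow> 'p \<Rightarrow> 'p \<Rightarrow> real) \<Rightarrow> real \<Rightarrow> real \<Rightarrow> 'v hypergraph \<Rightarrow> bool" where
  "contains_dual r V d a b H \<longleftrightarrow> (\<exists>\<phi>. is_duality r V d a b H \<phi>)"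

definition covered_by_balls ::
    "nat \<Rightarrow> 'p set \<Rightarrow> (nat \<Rightarrow> 'p \<Rightarrow> 'p \<Rightarrow> real) \<Rightarrow> nat \<Rightarrow> real \<Rightarrow> bool" where
  "covered_by_balls r V d c \<rho> \<longleftrightarrow>
     (\<exists>\<B>. finite \<B> \<and> card \<B> \<le> c \<and>
          (\<forall>B\<in>\<B>. \<exists>i\<in>{1..r}. \<exists>x\<in>V. B = Metric_space.mcball V (d i) x \<rho>) \<and>
          \<Union>\<B> = V)"

end

theory Submission
  imports Defs
begin

text \<open>
  A dual of \<open>H\<close> turns edges into points so that, in the metric \<open>d i\<close>, the points of the edges through
  a fixed vertex of part \<open>i\<close> form a cluster of diameter at most \<open>m\<close>, while different clusters are
  at least \<open>k * m\<close> apart. Let \<open>C\<close> be the cover that witnesses stability. Put a ball of radius \<open>k * m\<close> around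
  one point of the cluster of each vertex in \<open>C\<close>. If these balls cover \<open>V\<close>, the first alternative holds.

  Otherwise some point \<open>p\<close> is far from every cluster of \<open>C\<close> (\<open>far_point_if_not_covered\<close>). The point \<open>p\<close>
  is read as one further edge: in part \<open>i\<close> this edge uses the vertex of the cluster nearest to
  \<open>p\<close> if that cluster is near, and a fresh vertex if all clusters are far away. The edge avoids \<open>C\<close>,
  so \<open>C\<close> does not cover the enlarged hypergraph, and stability yields a copy of some
  \<open>Hs i\<close> in it. A dual of the enlarged hypergraph then restricts to a dual of \<open>Hs i\<close>
  (\<open>contains_dual_of_copy\<close>).

  What remains is to choose \<open>m'\<close> such that ``near'' and ``far'' are separated by the factor
  \<open>q = k powr (1 / (4 * r))\<close>. The only distances that matter are those from \<open>p\<close> to its nearest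
  cluster, one for each of the \<open>r\<close> metrics, however many edges \<open>H\<close> has. The \<open>r + 1\<close> intervals
  between consecutive terms of \<open>m * (2 * q) ^ j\<close> are disjoint, so one of them contains none of
  these \<open>r\<close> distances (\<open>interval_missed_by_finite_family\<close>). The factor \<open>2\<close> leaves room for the
  diameter \<open>m\<close> of a cluster. Finally, \<open>k\<close> is so large that \<open>(q + 1) * m'\<close> does not exceed the distance
  \<open>k * m\<close> between clusters, whence a point near one cluster is far from all others
  (\<open>scales_below_ratio\<close>).
\<close>

section \<open>Choosing the scale\<close>

text \<open>The intervals are disjoint and there is one more of them than there are values.\<close>

lemma interval_missed_by_finite_family:
  fixes a :: "nat \<Rightarrow> 'a::linorder"
  assumes "mono a" and "finite I"
  obtains j where "j \<le> card I" and "\<And>i. i \<in> I \<Longrightarrow> \<delta> i \<le> a j \<or> a (Suc j) \<le> \<delta> i"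
proof -
  have "\<exists>j\<le>card I. \<forall>i\<in>I. \<delta> i \<le> a j \<or> a (Suc j) \<le> \<delta> i"
  proof (rule ccontr)
    assume "\<not> ?thesis"
    then have "\<forall>j\<in>{..card I}. \<exists>i\<in>I. a j < \<delta> i \<and> \<delta> i < a (Suc j)"
      by (meson atMost_iff not_le)
    then obtain g where g: "\<And>j. j \<le> card I \<Longrightarrow> g j \<in> I \<and> a j < \<delta> (g j) \<and> \<delta> (g j) < a (Suc j)"
      by (metis atMost_iff)
    have "g j \<noteq> g j'" if "j < j'" "j' \<le> card I" for j j'
    proof -
      have "\<delta> (g j) < a (Suc j)" using g[of j] that by simp
      also have "\<dots> \<le> a j'" using that monoD[OF assms(1)] by simp
      also have "\<dots> < \<delta> (g j')" using g[of j'] that by simp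
      finally show ?thesis by auto
    qed
    then have "inj_on g {..card I}"
      by (metis (mono_tags, lifting) atMost_iff inj_onI linorder_neqE_nat)
    moreover have "g ` {..card I} \<subseteq> I" using g by auto
    ultimately have "card {..card I} \<le> card I"
      using card_inj_on_le assms(2) by blast
    then show False by simp
  qed
  then show thesis using that by blast
qed

text \<open>Here \<open>k = q ^ (4 * r)\<close>. As \<open>q > 2\<close>, every factor \<open>2\<close> on the left is at most \<open>q\<close>, so that the left-hand
  side is at most \<open>q ^ (2 * r + 3)\<close>; this is below \<open>q ^ (4 * r)\<close> because \<open>r \<ge> 2\<close>.\<close>

lemma scales_below_ratio:
  fixes k q :: real
  assumes "r \<ge> 2" and "k > 2 ^ (9 * r)" and q: "q = k powr (1 / (4 * real r))" and "j \<le> r"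
  shows "q > 2" and "2 * (q + 1) * (2 * q) ^ j \<le> k"
proof -
  have k: "k > 0" using assms(2) by (meson less_trans zero_less_numeral zero_less_power)
  have qk: "q ^ (4 * r) = k"
  proof -
    have "q ^ (4 * r) = q powr real (4 * r)"
      using k q by (subst powr_realpow) auto
    also have "\<dots> = k" using k assms(1) unfolding q by (simp add: powr_powr)
    finally show ?thesis .
  qed
  have "(2::real) ^ (4 * r) \<le> 2 ^ (9 * r)" by (rule power_increasing) auto
  then have "2 ^ (4 * r) < q ^ (4 * r)" using assms(2) qk by linarith
  moreover have "q \<ge> 0" using q by simp
  ultimately show q2: "q > 2" using power_less_imp_less_base by blast
  have "2 * (q + 1) * (2 * q) ^ j \<le> q * (q * q) * (q * q) ^ j"
    using q2 by (intro mult_mono power_mono) (auto intro: order_trans[of _ "2 * q"])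
  also have "\<dots> = q ^ (2 * j + 3)" by (simp add: power_add power_mult power_mult_distrib power2_eq_square eval_nat_numeral)
  also have "\<dots> \<le> q ^ (4 * r)" using q2 assms(1,4) by (intro power_increasing) auto
  finally show "2 * (q + 1) * (2 * q) ^ j \<le> k" using qk by simp
qed

section \<open>Partite hypergraphs and duals of copies\<close>

lemma uniform_partite_vertex_in_part:
  assumes "uniform_partite r H" and "e \<in> edges H" and "i \<in> {1..r}"
  obtains v where "e \<inter> part H i = {v}"
  using assms unfolding uniform_partite_def by (metis card_1_singletonE)

lemma uniform_partite_share_vertex_iff:
  assumes "uniform_partite r H" and "e \<in> edges H" and "f \<in> edges H" and "i \<in> {1..r}"
    and "v \<in> e" and "v \<in> part H i"
  shows "e \<inter> part H i = f \<inter> part H i \<longleftrightarrow> v \<in> f"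
proof -
  obtain s t where s: "e \<inter> part H i = {s}" and t: "f \<inter> part H i = {t}"
    using uniform_partite_vertex_in_part[OF assms(1,2,4)]
      uniform_partite_vertex_in_part[OF assms(1,3,4)] by metis
  have "v \<in> e \<inter> part H i" using assms(5,6) by simp
  then have "s = v" using s by simp
  moreover have "v \<in> f \<longleftrightarrow> v \<in> f \<inter> part H i" using assms(6) by simp
  ultimately show ?thesis unfolding s t by auto
qed

lemma uniform_partite_edge_subset_verts:
  "uniform_partite r H \<Longrightarrow> e \<in> edges H \<Longrightarrow> e \<subseteq> verts r H"
  by (simp add: uniform_partite_def)

lemma uniform_partite_part_unique:
  assumes "uniform_partite r H" and "i \<in> {1..r}" and "j \<in> {1..r}"
    and "v \<in> part H i" and "v \<in> part H j"
  shows "i = j"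
  using assms unfolding uniform_partite_def disjoint_family_on_def by blast

lemma uniform_partite_finite_edges:
  assumes "uniform_partite r H"
  shows "finite (edges H)"
proof (rule finite_subset)
  show "edges H \<subseteq> Pow (verts r H)" using assms by (auto simp: uniform_partite_def)
  show "finite (Pow (verts r H))" using assms by (simp add: uniform_partite_def)
qed

text \<open>A larger hypergraph may have larger parts, but an edge of the smaller one already has its only
  vertex of part \<open>i\<close> in the smaller part.\<close>

lemma subhypergraph_edge_Int_part:
  assumes "uniform_partite r G" and "uniform_partite r H" and "subhypergraph r G H"
    and "e \<in> edges G" and "i \<in> {1..r}"
  shows "e \<inter> part H i = e \<inter> part G i"
proof -
  obtain v where v: "e \<inter> part G i = {v}"
    using uniform_partite_vertex_in_part[OF assms(1,4,5)] .
  have "e \<in> edges H" using assms(3,4) by (auto simp: subhypergraph_def)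
  then obtain w where w: "e \<inter> part H i = {w}"
    using uniform_partite_vertex_in_part[OF assms(2) _ assms(5)] by blast
  have "part G i \<subseteq> part H i" using assms(3,5) by (simp add: subhypergraph_def)
  then have "e \<inter> part G i \<subseteq> e \<inter> part H i" by (rule Int_mono[OF subset_refl])
  then show ?thesis unfolding v w by simp
qed

lemma is_duality_dist:
  assumes \<phi>: "is_duality r V d a b H \<phi>"
    and e: "e \<in> edges H" "f \<in> edges H" "e \<noteq> f" and i: "i \<in> {1..r}"
  shows "e \<inter> part H i = f \<inter> part H i \<Longrightarrow> d i (\<phi> e) (\<phi> f) \<le> a"
    and "e \<inter> part H i \<noteq> f \<inter> part H i \<Longrightarrow> b \<le> d i (\<phi> e) (\<phi> f)"
proof -
  have "\<forall>e\<in>edges H. \<forall>f\<in>edges H. e \<noteq> f \<longrightarrow> (\<forall>i\<in>{1..r}.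
      (e \<inter> part H i = f \<inter> part H i \<longrightarrow> d i (\<phi> e) (\<phi> f) \<le> a) \<and>
      (e \<inter> part H i \<noteq> f \<inter> part H i \<longrightarrow> b \<le> d i (\<phi> e) (\<phi> f)))"
    using \<phi> unfolding is_duality_def by (elim conjE)
  note * = bspec[OF mp[OF bspec[OF bspec[OF this e(1)] e(2)] e(3)] i]
  show "e \<inter> part H i = f \<inter> part H i \<Longrightarrow> d i (\<phi> e) (\<phi> f) \<le> a"
    by (rule mp[OF conjunct1[OF *]])
  show "e \<inter> part H i \<noteq> f \<inter> part H i \<Longrightarrow> b \<le> d i (\<phi> e) (\<phi> f)"
    by (rule mp[OF conjunct2[OF *]])
qed

text \<open>An isomorphism that respects the parts preserves which edges share their vertex in part \<open>i\<close>, and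
  the conditions on a dual depend on nothing else.\<close>

lemma contains_dual_of_copy:
  assumes F: "uniform_partite r F" and H: "uniform_partite r H"
    and "contains_copy r H F" and "contains_dual r V d a b H"
  shows "contains_dual r V d a b F"
proof -
  obtain G f where G: "uniform_partite r G" and GH: "subhypergraph r G H"
    and inj: "inj_on f (verts r F)" and parts: "\<And>i. i \<in> {1..r} \<Longrightarrow> f ` part F i = part G i"
    and edgs: "(\<lambda>e. f ` e) ` edges F = edges G"
    using assms(3) by (auto simp: contains_copy_def partite_iso_def bij_betw_def)
  obtain \<phi> where \<phi>: "is_duality r V d a b H \<phi>" using assms(4) by (auto simp: contains_dual_def)
  have inG: "f ` e \<in> edges G" if "e \<in> edges F" for e using that edgs by auto
  have GsubH: "edges G \<subseteq> edges H" using GH by (simp add: subhypergraph_def)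
  have sub: "e \<subseteq> verts r F" if "e \<in> edges F" for e
    using uniform_partite_edge_subset_verts[OF F that] .
  have injE: "inj_on (\<lambda>e. f ` e) (edges F)"
    using inj_on_image_eq_iff[OF inj] sub by (auto simp: inj_on_def)
  have share: "f ` e \<inter> part H i = f ` e' \<inter> part H i \<longleftrightarrow> e \<inter> part F i = e' \<inter> part F i"
    if e: "e \<in> edges F" "e' \<in> edges F" "i \<in> {1..r}" for e e' i
  proof -
    have pF: "part F i \<subseteq> verts r F" using e by (auto simp: verts_def)
    have eq: "f ` e0 \<inter> part H i = f ` (e0 \<inter> part F i)" if "e0 \<in> edges F" for e0
      using subhypergraph_edge_Int_part[OF G H GH inG[OF that] e(3)] parts[OF e(3)]
        inj_on_image_Int[OF inj sub[OF that] pF] by simp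
    show ?thesis
      unfolding eq[OF e(1)] eq[OF e(2)] by (rule inj_on_image_eq_iff[OF inj]) (use pF in auto)
  qed
  have "is_duality r V d a b F (\<lambda>e. \<phi> (f ` e))"
    unfolding is_duality_def
  proof (intro conjI ballI impI)
    show "a < b" using \<phi> by (simp add: is_duality_def)
    have "inj_on \<phi> ((\<lambda>e. f ` e) ` edges F)"
      using \<phi> edgs GsubH by (auto simp: is_duality_def intro: inj_on_subset)
    from comp_inj_on[OF injE this] show "inj_on (\<lambda>e. \<phi> (f ` e)) (edges F)" by (simp add: comp_def)
    show "(\<lambda>e. \<phi> (f ` e)) ` edges F \<subseteq> V" using \<phi> inG GsubH by (auto simp: is_duality_def)
  next
    fix e e' i
    assume e: "e \<in> edges F" "e' \<in> edges F" "e \<noteq> e'" "i \<in> {1..r}"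
    have ne: "f ` e \<noteq> f ` e'" and inH: "f ` e \<in> edges H" "f ` e' \<in> edges H"
      using e injE inG GsubH by (auto dest: inj_onD)
    show "d i (\<phi> (f ` e)) (\<phi> (f ` e')) \<le> a" if "e \<inter> part F i = e' \<inter> part F i"
      using is_duality_dist(1)[OF \<phi> inH ne e(4)] that share[OF e(1,2,4)] by simp
    show "b \<le> d i (\<phi> (f ` e)) (\<phi> (f ` e'))" if "e \<inter> part F i \<noteq> e' \<inter> part F i"
      using is_duality_dist(2)[OF \<phi> inH ne e(4)] that share[OF e(1,2,4)] by simp
  qed
  then show ?thesis by (auto simp: contains_dual_def)
qed

section \<open>Adding one edge\<close>

text \<open>The edge to be added is given by its vertex \<open>x i\<close> in each part and the parts are enlarged by
  fresh vertices \<open>w i\<close>, which the edge may or may not use.\<close>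

definition add_edge :: "nat \<Rightarrow> (nat \<Rightarrow> 'v) \<Rightarrow> (nat \<Rightarrow> 'v) \<Rightarrow> 'v hypergraph \<Rightarrow> 'v hypergraph" where
  "add_edge r w x H = \<lparr>part = \<lambda>i. insert (w i) (part H i), edges = insert (x ` {1..r}) (edges H)\<rparr>"

lemma subhypergraph_add_edge: "subhypergraph r H (add_edge r w x H)"
  by (auto simp: subhypergraph_def add_edge_def)

lemma uniform_partite_add_edge:
  assumes H: "uniform_partite r H" and w: "inj_on w {1..r}" "w ` {1..r} \<inter> verts r H = {}"
    and x: "\<And>i. i \<in> {1..r} \<Longrightarrow> x i \<in> insert (w i) (part H i)"
  shows "uniform_partite r (add_edge r w x H)"
    and "i \<in> {1..r} \<Longrightarrow> x ` {1..r} \<inter> part (add_edge r w x H) i = {x i}"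
proof -
  let ?H = "add_edge r w x H"
  have verts: "verts r ?H = w ` {1..r} \<union> verts r H"
    by (auto simp: verts_def add_edge_def)
  have wp: "w i \<notin> part H j" if "i \<in> {1..r}" "j \<in> {1..r}" for i j
    using w(2) that unfolding verts_def by blast
  have part_unique: "i = j"
    if "i \<in> {1..r}" "j \<in> {1..r}" "v \<in> part ?H i" "v \<in> part ?H j" for i j v
    using that wp w(1) uniform_partite_part_unique[OF H that(1,2)]
    by (auto simp: add_edge_def dest: inj_onD)
  have xp: "x i \<in> part ?H i" if "i \<in> {1..r}" for i using x[OF that] by (simp add: add_edge_def)
  show xi: "x ` {1..r} \<inter> part ?H i = {x i}" if "i \<in> {1..r}" for i
    using that xp part_unique by blast
  have "inj_on x {1..r}"
    using xp part_unique by (metis inj_onI)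
  then have cardx: "card (x ` {1..r}) = r" by (simp add: card_image)
  have old: "e \<inter> part ?H i = e \<inter> part H i" if "e \<in> edges H" "i \<in> {1..r}" for e i
    using that w(2) uniform_partite_edge_subset_verts[OF H that(1)] unfolding add_edge_def by fastforce
  show "uniform_partite r ?H"
    unfolding uniform_partite_def
  proof (intro conjI ballI)
    show "finite (verts r ?H)" using H verts by (simp add: uniform_partite_def)
    show "disjoint_family_on (part ?H) {1..r}"
      using part_unique by (fastforce simp: disjoint_family_on_def)
  next
    fix e assume "e \<in> edges ?H"
    then consider "e = x ` {1..r}" | "e \<in> edges H" by (auto simp: add_edge_def)
    then have "e \<subseteq> verts r ?H \<and> card e = r"
    proof cases
      case 1
      have "x ` {1..r} \<subseteq> verts r ?H" using xp unfolding verts_def by blast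
      then show ?thesis using cardx 1 by simp
    next
      case 2
      then show ?thesis using H verts unfolding uniform_partite_def by blast
    qed
    then show "e \<subseteq> verts r ?H" and "card e = r" by blast+
  next
    fix e i assume "e \<in> edges ?H" and i: "i \<in> {1..r}"
    then consider "e = x ` {1..r}" | "e \<in> edges H" by (auto simp: add_edge_def)
    then show "card (e \<inter> part ?H i) = 1"
    proof cases
      case 1
      then show ?thesis using xi[OF i] by simp
    next
      case 2
      then show ?thesis using old[OF 2 i] H i by (simp add: uniform_partite_def)
    qed
  qed
qed

text \<open>The new edge is represented by \<open>p\<close>. Incidence with \<open>x i\<close> decides whether an old edge shares its vertex in
  part \<open>i\<close> with the new one.\<close>

lemma is_duality_add_edge:
  assumes H: "uniform_partite r H" and H': "uniform_partite r (add_edge r w x H)"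
    and new: "\<And>i. i \<in> {1..r} \<Longrightarrow> x ` {1..r} \<inter> part (add_edge r w x H) i = {x i}"
      "x ` {1..r} \<notin> edges H"
    and \<phi>: "is_duality r V d a b H \<phi>" and V: "metric_family r V d"
    and ab: "a \<le> a'" "a' < b'" "b' \<le> b"
    and p: "p \<in> V" "p \<notin> \<phi> ` edges H"
    and near: "\<And>i e. \<lbrakk>i \<in> {1..r}; e \<in> edges H; x i \<in> e\<rbrakk> \<Longrightarrow> d i p (\<phi> e) \<le> a'"
    and far: "\<And>i e. \<lbrakk>i \<in> {1..r}; e \<in> edges H; x i \<notin> e\<rbrakk> \<Longrightarrow> b' \<le> d i p (\<phi> e)"
  shows "is_duality r V d a' b' (add_edge r w x H) (\<phi>(x ` {1..r} := p))"
proof -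
  let ?H = "add_edge r w x H" and ?f = "x ` {1..r}"
  let ?\<psi> = "\<phi>(?f := p)"
  have edgs: "edges ?H = insert ?f (edges H)" by (simp add: add_edge_def)
  have old: "e \<inter> part ?H i = e \<inter> part H i" if "e \<in> edges H" "i \<in> {1..r}" for e i
    using subhypergraph_edge_Int_part[OF H H' subhypergraph_add_edge that] .
  have share: "e \<inter> part ?H i = ?f \<inter> part ?H i \<longleftrightarrow> x i \<in> e"
    if e: "e \<in> edges H" and i: "i \<in> {1..r}" for e i
  proof -
    obtain v where "e \<inter> part ?H i = {v}"
      using uniform_partite_vertex_in_part[OF H' _ i] e edgs by blast
    then show ?thesis using new(1)[OF i] by auto
  qed
  have sym: "d i u v = d i v u" if "i \<in> {1..r}" for i u v
    using V that unfolding metric_family_def by (meson Metric_space.commute)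
  have eq: "?\<psi> e = \<phi> e" if "e \<in> edges H" for e using that new(2) by auto
  show ?thesis
    unfolding is_duality_def
  proof (intro conjI)
    show "a' < b'" by fact
    have "inj_on ?\<psi> (edges H)" using \<phi> eq inj_on_cong[of "edges H" ?\<psi> \<phi>]
      by (auto simp: is_duality_def)
    moreover have "?\<psi> ` edges H = \<phi> ` edges H" using eq by (auto intro!: image_cong)
    ultimately show "inj_on ?\<psi> (edges ?H)"
      using p new(2) unfolding edgs inj_on_insert by simp
    show "?\<psi> ` edges ?H \<subseteq> V" using \<phi> p eq unfolding edgs is_duality_def by auto
    show "\<forall>e\<in>edges ?H. \<forall>f\<in>edges ?H. e \<noteq> f \<longrightarrow> (\<forall>i\<in>{1..r}.
        (e \<inter> part ?H i = f \<inter> part ?H i \<longrightarrow> d i (?\<psi> e) (?\<psi> f) \<le> a') \<and>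
        (e \<inter> part ?H i \<noteq> f \<inter> part ?H i \<longrightarrow> b' \<le> d i (?\<psi> e) (?\<psi> f)))"
    proof (intro ballI impI)
      fix e f i
      assume e: "e \<in> edges ?H" and f: "f \<in> edges ?H" and ef: "e \<noteq> f" and i: "i \<in> {1..r}"
      consider "e \<in> edges H" "f \<in> edges H" | "e = ?f" "f \<in> edges H" | "e \<in> edges H" "f = ?f"
        using e f ef edgs by blast
      then show "(e \<inter> part ?H i = f \<inter> part ?H i \<longrightarrow> d i (?\<psi> e) (?\<psi> f) \<le> a') \<and>
        (e \<inter> part ?H i \<noteq> f \<inter> part ?H i \<longrightarrow> b' \<le> d i (?\<psi> e) (?\<psi> f))"
      proof cases
        case 1
        show ?thesis
          using order_trans[OF is_duality_dist(1)[OF \<phi> 1 ef i] ab(1)]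
            order_trans[OF ab(3) is_duality_dist(2)[OF \<phi> 1 ef i]]
          unfolding old[OF 1(1) i] old[OF 1(2) i] eq[OF 1(1)] eq[OF 1(2)] by (intro conjI impI)
      next
        case 2
        have "?\<psi> e = p" using 2 by simp
        then show ?thesis
          using share[OF 2(2) i] near[OF i 2(2)] far[OF i 2(2)] eq[OF 2(2)] 2(1) by auto
      next
        case 3
        have "?\<psi> f = p" using 3 by simp
        then show ?thesis
          using share[OF 3(1) i] near[OF i 3(1)] far[OF i 3(1)] eq[OF 3(1)] 3(2) sym[OF i] by auto
      qed
    qed
  qed
qed

section \<open>Points far from the cover\<close>

text \<open>One ball is placed at an arbitrary edge through each vertex of \<open>C\<close>; isolated vertices get no
  ball. The bound drops from \<open>b\<close> to \<open>b - a\<close> because the conclusion concerns all edges through the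
  vertex, which represent points at distance at most \<open>a\<close> from the centre.\<close>

lemma far_point_if_not_covered:
  assumes H: "uniform_partite r H" and V: "metric_family r V d" and \<phi>: "is_duality r V d a b H \<phi>"
    and "a \<ge> 0" and C: "C \<subseteq> verts r H" "card C \<le> c" and not_covered: "\<not> covered_by_balls r V d c b"
  obtains p where "p \<in> V"
    and "\<And>i e v. \<lbrakk>i \<in> {1..r}; e \<in> edges H; v \<in> e; v \<in> C; v \<in> part H i\<rbrakk> \<Longrightarrow> b - a < d i p (\<phi> e)"
proof -
  define D where "D = {v \<in> C. \<exists>e\<in>edges H. v \<in> e}"
  have "\<forall>v\<in>D. \<exists>i e. i \<in> {1..r} \<and> v \<in> part H i \<and> e \<in> edges H \<and> v \<in> e"
    using C(1) by (fastforce simp: D_def verts_def)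
  then obtain I E where IE: "\<And>v. v \<in> D \<Longrightarrow> I v \<in> {1..r} \<and> v \<in> part H (I v) \<and> E v \<in> edges H \<and> v \<in> E v"
    by metis
  define B where "B v = Metric_space.mcball V (d (I v)) (\<phi> (E v)) b" for v
  have M: "Metric_space V (d i)" if "i \<in> {1..r}" for i using V that by (simp add: metric_family_def)
  have \<phi>V: "\<phi> e \<in> V" if "e \<in> edges H" for e using \<phi> that by (auto simp: is_duality_def)
  have finC: "finite C" using C(1) H by (auto simp: uniform_partite_def intro: finite_subset)
  have "D \<subseteq> C" by (auto simp: D_def)
  then have finD: "finite D" and cardD: "card D \<le> card C"
    using finC finite_subset card_mono by blast+
  have BV: "B v \<subseteq> V" if "v \<in> D" for v
    unfolding B_def using Metric_space.mcball_subset_mspace[OF M] IE[OF that] by blast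
  have "\<Union>(B ` D) \<noteq> V"
  proof
    assume "\<Union>(B ` D) = V"
    moreover have "card (B ` D) \<le> c" using card_image_le[OF finD, of B] cardD C(2) by linarith
    moreover have "\<exists>i\<in>{1..r}. \<exists>x\<in>V. B v = Metric_space.mcball V (d i) x b" if "v \<in> D" for v
      unfolding B_def using IE[OF that] \<phi>V by blast
    ultimately have "covered_by_balls r V d c b"
      unfolding covered_by_balls_def using finD by (intro exI[of _ "B ` D"]) auto
    then show False using not_covered by blast
  qed
  then obtain p where p: "p \<in> V" "\<And>v. v \<in> D \<Longrightarrow> p \<notin> B v" using BV by blast
  have "b - a < d i p (\<phi> e)"
    if i: "i \<in> {1..r}" and e: "e \<in> edges H" "v \<in> e" and v: "v \<in> C" "v \<in> part H i" for i e v
  proof -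
    interpret Metric_space V "d i" using M[OF i] .
    have vD: "v \<in> D" using e v by (auto simp: D_def)
    note E = IE[OF vD]
    have Iv: "I v = i" using uniform_partite_part_unique[OF H] E i v by blast
    have "b < d i (\<phi> (E v)) p"
      using p(2)[OF vD] p(1) \<phi>V E unfolding B_def Iv by auto
    moreover have "d i (\<phi> (E v)) (\<phi> e) \<le> a"
    proof (cases "E v = e")
      case True
      then show ?thesis using assms(4) \<phi>V e by simp
    next
      case False
      have "E v \<inter> part H i = e \<inter> part H i"
        using uniform_partite_share_vertex_iff[OF H _ e(1) i _ v(2)] E e(2) by blast
      then show ?thesis using is_duality_dist(1)[OF \<phi> _ e(1) False i] E by blast
    qed
    moreover have "d i (\<phi> (E v)) p \<le> d i (\<phi> (E v)) (\<phi> e) + d i (\<phi> e) p"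
      using triangle \<phi>V E e p by blast
    ultimately show ?thesis by (simp add: commute)
  qed
  then show thesis using that p(1) by blast
qed

section \<open>Ball covers or duals of forbidden hypergraphs\<close>

theorem lemma6p4:
  fixes r c l :: nat and k m :: real
    and H :: "'v::infinite hypergraph" and Hs :: "nat \<Rightarrow> 'w hypergraph"
    and V :: "'p set" and d :: "nat \<Rightarrow> 'p \<Rightarrow> 'p \<Rightarrow> real"
  assumes "r \<ge> 2" and "k > 2 ^ (9 * r)" and "m > 0"
    and "uniform_partite r H"
    and "\<forall>i\<in>{1..l}. uniform_partite r (Hs i)"
    and "ryser_stable r c H l Hs"
    and "metric_family r V d"
    and "contains_dual r V d m (k * m) H"
  shows "covered_by_balls r V d c (k * m) \<or>
    (\<exists>m'. m \<le> m' \<and> m' \<le> k * m \<and>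
       (\<exists>i\<in>{1..l}. contains_dual r V d m' (k powr (1 / (4 * real r)) * m') (Hs i)))"
proof (subst disj_imp, rule impI)
  assume not_covered: "\<not> covered_by_balls r V d c (k * m)"
  note H = assms(4)
  obtain \<phi> where \<phi>: "is_duality r V d m (k * m) H \<phi>"
    using assms(8) by (auto simp: contains_dual_def)
  obtain C where C: "vertex_cover r H C" "card C \<le> c"
    and stable: "\<And>H'. \<lbrakk>uniform_partite r H'; subhypergraph r H H'\<rbrakk> \<Longrightarrow>
      vertex_cover r H' C \<or> (\<exists>i\<in>{1..l}. contains_copy r H' (Hs i))"
    using assms(6) by (auto simp: ryser_stable_def)
  obtain p where p: "p \<in> V" and p_far: "\<And>i e v. \<lbrakk>i \<in> {1..r}; e \<in> edges H; v \<in> e; v \<in> C; v \<in> part H i\<rbrakk>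
      \<Longrightarrow> k * m - m < d i p (\<phi> e)"
    using far_point_if_not_covered[OF H assms(7) \<phi> _ _ C(2) not_covered] C(1) assms(3)
    by (auto simp: vertex_cover_def)

  define q where "q = k powr (1 / (4 * real r))"
  define a where "a j = m * (2 * q) ^ j" for j
  \<comment> \<open>If \<open>H\<close> has no edges, the minimum below is unspecified; all statements about distances to
    points of edges then hold vacuously.\<close>
  define \<delta> where "\<delta> i = Min ((\<lambda>e. d i p (\<phi> e)) ` edges H)" for i
  have q: "q > 2" using scales_below_ratio(1)[OF assms(1,2) q_def] by blast
  have "mono a"
    unfolding a_def using q assms(3) by (intro monoI mult_left_mono power_increasing) auto
  then obtain j where "j \<le> card {1..r}"
    and gap: "\<And>i. i \<in> {1..r} \<Longrightarrow> \<delta> i \<le> a j \<or> a (Suc j) \<le> \<delta> i"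
    using interval_missed_by_finite_family[of a "{1..r}" \<delta>] by blast
  then have j: "j \<le> r" by simp
  \<comment> \<open>Near means within \<open>a j\<close> of \<open>p\<close>, so that the whole cluster is within \<open>a j + m\<close>, at most \<open>2 * a j\<close>.\<close>
  define m' where "m' = 2 * a j"
  have "1 \<le> (2 * q) ^ j" using q by (intro one_le_power) simp
  then have am: "m \<le> a j" using assms(3) by (simp add: a_def)
  have qm': "q * m' = a (Suc j)" by (simp add: m'_def a_def)
  have "(2 * (q + 1) * (2 * q) ^ j) * m \<le> k * m"
    using scales_below_ratio(2)[OF assms(1,2) q_def j] assms(3) by (intro mult_right_mono) auto
  then have km: "q * m' + m' \<le> k * m" by (simp add: m'_def a_def algebra_simps)
  have m': "m' > 0" "m' < q * m'" using q am assms(3) by (auto simp: m'_def)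

  obtain w :: "nat \<Rightarrow> 'v" where w: "inj w" "range w \<subseteq> - verts r H"
    using infinite_countable_subset[of "- verts r H"] H infinite_UNIV
    by (metis Compl_eq_Diff_UNIV Diff_infinite_finite uniform_partite_def)
  have \<phi>V: "\<phi> e \<in> V" if "e \<in> edges H" for e using \<phi> that by (auto simp: is_duality_def)
  \<comment> \<open>The new edge takes the vertex of the near cluster in part \<open>i\<close>, if there is one, and \<open>w i\<close> otherwise.\<close>
  have new_vertex: "\<forall>i\<in>{1..r}. \<exists>x. x \<in> insert (w i) (part H i) \<and> x \<notin> C \<and>
      (\<forall>e\<in>edges H. (x \<in> e \<longrightarrow> d i p (\<phi> e) \<le> m') \<and> (x \<notin> e \<longrightarrow> q * m' \<le> d i p (\<phi> e)))"
    (is "\<forall>i\<in>_. \<exists>x. _ \<and> ?Q i x")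
  proof
    fix i assume i: "i \<in> {1..r}"
    show "\<exists>x. x \<in> insert (w i) (part H i) \<and> ?Q i x"
    proof (cases "\<exists>e\<in>edges H. d i p (\<phi> e) \<le> a j")
      case True
      then obtain e0 where e0: "e0 \<in> edges H" "d i p (\<phi> e0) \<le> a j" by blast
      obtain x where x: "e0 \<inter> part H i = {x}"
        using uniform_partite_vertex_in_part[OF H e0(1) i] .
      then have "x \<in> e0" "x \<in> part H i" by auto
      then have share: "e0 \<inter> part H i = e \<inter> part H i \<longleftrightarrow> x \<in> e" if "e \<in> edges H" for e
        using uniform_partite_share_vertex_iff[OF H e0(1) that i] by blast
      interpret Metric_space V "d i" using assms(7) i unfolding metric_family_def by blast
      have "x \<notin> C"
      proof
        assume "x \<in> C"
        then have "k * m - m < a j" using p_far[OF i e0(1), of x] x e0(2) by fastforce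
        then show False using km m' am unfolding m'_def by linarith
      qed
      moreover have "d i p (\<phi> e) \<le> m'" if e: "e \<in> edges H" "x \<in> e" for e
      proof (cases "e = e0")
        case True
        then show ?thesis using e0(2) am assms(3) by (simp add: m'_def)
      next
        case False
        have "e0 \<inter> part H i = e \<inter> part H i" using share[OF e(1)] e(2) by simp
        then have "d i (\<phi> e0) (\<phi> e) \<le> m"
          using is_duality_dist(1)[OF \<phi> e0(1) e(1) _ i] False by blast
        moreover have "d i p (\<phi> e) \<le> d i p (\<phi> e0) + d i (\<phi> e0) (\<phi> e)"
          using triangle p \<phi>V e e0 by blast
        ultimately show ?thesis using e0(2) am by (simp add: m'_def)
      qed
      moreover have "q * m' \<le> d i p (\<phi> e)" if e: "e \<in> edges H" "x \<notin> e" for e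
      proof -
        have "e0 \<inter> part H i \<noteq> e \<inter> part H i" "e \<noteq> e0" using share[OF e(1)] e(2) by auto
        then have "k * m \<le> d i (\<phi> e0) (\<phi> e)"
          using is_duality_dist(2)[OF \<phi> e0(1) e(1) _ i] by blast
        moreover have "d i (\<phi> e0) (\<phi> e) \<le> d i (\<phi> e0) p + d i p (\<phi> e)"
          using triangle p \<phi>V e e0 by blast
        ultimately show ?thesis using e0(2) km am assms(3) commute[of p "\<phi> e0"] m'_def by linarith
      qed
      ultimately show ?thesis using x by (intro exI[of _ x]) auto
    next
      case False
      have fin: "finite ((\<lambda>e. d i p (\<phi> e)) ` edges H)" using uniform_partite_finite_edges[OF H] by simp
      have "q * m' \<le> d i p (\<phi> e)" if e: "e \<in> edges H" for e
      proof -
        have "\<delta> i \<in> (\<lambda>e. d i p (\<phi> e)) ` edges H"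
          unfolding \<delta>_def using fin e by (intro Min_in) auto
        then have "a (Suc j) \<le> \<delta> i" using False gap[OF i] by auto
        also have "\<dots> \<le> d i p (\<phi> e)" unfolding \<delta>_def using fin e by (intro Min_le) auto
        finally show ?thesis by (simp add: qm')
      qed
      moreover have "w i \<notin> e" if "e \<in> edges H" for e
        using w(2) uniform_partite_edge_subset_verts[OF H that] by auto
      moreover have "w i \<notin> C" using w(2) C(1) by (auto simp: vertex_cover_def)
      ultimately show ?thesis by (intro exI[of _ "w i"]) auto
    qed
  qed
  from bchoice[OF new_vertex]
  obtain x where x0: "\<forall>i\<in>{1..r}. x i \<in> insert (w i) (part H i) \<and> ?Q i (x i)"
    by (elim exE)
  have x: "x i \<in> insert (w i) (part H i)" if "i \<in> {1..r}" for i
    using bspec[OF x0 that] by (rule conjunct1)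
  have Q: "?Q i (x i)" if "i \<in> {1..r}" for i
    using bspec[OF x0 that] by (rule conjunct2)
  have xC: "x i \<notin> C" if "i \<in> {1..r}" for i
    using Q[OF that] by (rule conjunct1)
  have near: "d i p (\<phi> e) \<le> m'" if "i \<in> {1..r}" "e \<in> edges H" "x i \<in> e" for i e
    using Q[OF that(1)] that(2,3) by blast
  have far: "q * m' \<le> d i p (\<phi> e)" if "i \<in> {1..r}" "e \<in> edges H" "x i \<notin> e" for i e
    using Q[OF that(1)] that(2,3) by blast

  let ?H = "add_edge r w x H"
  have w': "inj_on w {1..r}" "w ` {1..r} \<inter> verts r H = {}"
    using w by (auto intro: inj_on_subset)
  note H' = uniform_partite_add_edge[OF H w' x]
  have avoid: "x ` {1..r} \<inter> C = {}" using xC by auto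
  then have new: "x ` {1..r} \<notin> edges H" using C(1) by (auto simp: vertex_cover_def)
  have "p \<noteq> \<phi> e" if e: "e \<in> edges H" for e
  proof
    assume pe: "p = \<phi> e"
    obtain v i where v: "v \<in> e" "v \<in> C" "v \<in> part H i" "i \<in> {1..r}"
      using C(1) e uniform_partite_edge_subset_verts[OF H e] by (fastforce simp: vertex_cover_def verts_def)
    interpret Metric_space V "d i" using assms(7) v unfolding metric_family_def by blast
    have "k * m - m < 0" using p_far[OF v(4) e v(1-3)] pe p by simp
    then show False using km m' am assms(3) unfolding m'_def by linarith
  qed
  then have p_new: "p \<notin> \<phi> ` edges H" by blast
  have dual: "contains_dual r V d m' (q * m') ?H"
    unfolding contains_dual_def
    by (rule exI, rule is_duality_add_edge[OF H H'(1) H'(2) new \<phi> assms(7) _ _ _ p p_new near far])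
      (use km m' am assms(3) m'_def in linarith)+
  have "\<not> vertex_cover r ?H C"
    using avoid by (auto simp: vertex_cover_def add_edge_def)
  then obtain i where i: "i \<in> {1..l}" "contains_copy r ?H (Hs i)"
    using stable[OF H'(1) subhypergraph_add_edge] by blast
  have "contains_dual r V d m' (q * m') (Hs i)"
    using contains_dual_of_copy[OF bspec[OF assms(5) i(1)] H'(1) i(2) dual] .
  moreover have "m \<le> m'" "m' \<le> k * m" using am assms(3) km m' m'_def by linarith+
  ultimately show "\<exists>m'. m \<le> m' \<and> m' \<le> k * m \<and>
      (\<exists>i\<in>{1..l}. contains_dual r V d m' (k powr (1 / (4 * real r)) * m') (Hs i))"
    using i(1) unfolding q_def by blast
qed

end
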